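(* Let $X$ be a metric space and let $Y\subseteq X$ be a separable subspace. Then there exists a $G_\delta$ set $G\subseteq X$ such that $Y\subseteq G$ and $\dim_{tH}G=\dim_{tH}Y$.
   Context: $\dim_H$ denotes Hausdorff dimension, with the convention $\dim_H\emptyset=-1$. The topological Hausdorff dimension is defined by $\dim_{tH}\emptyset=-1$ and, for a non-empty metric space $X$, $\dim_{tH}X=\inf\{d: X \text{ has a basis } \mathcal U \text{ of open sets such that } \dim_H\partial U\le d-1 \text{ for every } U\in\mathcal U\}$ (where $d=\infty$ is allowed, with $\infty-1=\infty$). Subsets carry the subspace metric. *)

theory Defs
  imports "HOL-Analysis.Analysis"
begin

(* The s-th power of the diameter, with the usual conventions for Hausdorff measures: the empty set
   contributes 0 for every s (including s = 0), and every non-empty set contributes 1 when s = 0.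
   These differ from the value 0 powr 0 = 0. *)
definition diam_pow :: "real \<Rightarrow> 'a::metric_space set \<Rightarrow> real" where
  "diam_pow s C = (if C = {} then 0 else if s = 0 then 1 else diameter C powr s)"

(* Covers are by arbitrary subsets of the ambient type; intersecting them with A shows that the
   value depends only on the metric restricted to A. Boundedness is required because the library's
   real-valued diameter is meaningless on unbounded sets. If there is no countable cover by sets of
   diameter at most \<delta>, the infimum is \<infinity>. *)
definition hausdorff_premeasure :: "real \<Rightarrow> real \<Rightarrow> 'a::metric_space set \<Rightarrow> ennreal" where
  "hausdorff_premeasure s \<delta> A =
     (INF C \<in> {C :: nat \<Rightarrow> 'a set. A \<subseteq> (\<Union>i. C i) \<and> (\<forall>i. bounded (C i) \<and> diameter (C i) \<le> \<delta>)}.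
        \<Sum>i. ennreal (diam_pow s (C i)))"

definition hausdorff_measure :: "real \<Rightarrow> 'a::metric_space set \<Rightarrow> ennreal" where
  "hausdorff_measure s A = (SUP \<delta> \<in> {0<..}. hausdorff_premeasure s \<delta> A)"

(* The infimum is taken in the extended reals, so it is \<infinity> if no s qualifies. *)
definition hausdorff_dim :: "'a::metric_space set \<Rightarrow> ereal" where
  "hausdorff_dim A =
     (if A = {} then -1 else Inf {ereal s | s. 0 \<le> s \<and> hausdorff_measure s A = 0})"

definition is_base_of :: "'a set set \<Rightarrow> 'a topology \<Rightarrow> bool" where
  "is_base_of \<U> T \<longleftrightarrow> openin T = arbitrary union_of (\<lambda>U. U \<in> \<U>)"

(* The boundary is the one relative to the subspace A. Letting d range over all of ereal is harmless:
   hausdorff_dim is at least -1 and a base of a non-empty space is non-empty, so only d \<ge> 0 can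
   satisfy the condition; d = \<infinity> always does, as \<infinity> - 1 = \<infinity> in ereal. *)
definition top_hausdorff_dim :: "'a::metric_space set \<Rightarrow> ereal" where
  "top_hausdorff_dim A =
     (if A = {} then -1
      else Inf {d. \<exists>\<U>. is_base_of \<U> (top_of_set A) \<and>
                       (\<forall>U\<in>\<U>. hausdorff_dim (top_of_set A frontier_of U) \<le> d - 1)})"

end

theory Submission
  imports Defs
begin

text \<open>
  Every set has a \<open>G\<^sub>\<delta>\<close> hull of the same Hausdorff dimension, since the covers witnessing
  \<open>H\<^sup>s = 0\<close> can be fattened to open ones. Given a base of \<open>Y\<close> whose boundaries have dimension at
  most \<open>d - 1\<close>, extract for each scale a countable cover of \<open>Y\<close> by small base sets and extend
  these to small open sets \<open>V\<close> of the ambient space with no new boundary points on \<open>Y\<close>. Keep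
  only points covered at every scale and remove from each boundary \<open>\<partial>V\<close> everything outside a
  \<open>G\<^sub>\<delta>\<close> hull of \<open>\<partial>V \<inter> Y\<close>. What remains is a \<open>G\<^sub>\<delta>\<close> set containing \<open>Y\<close> on which the
  traces of the \<open>V\<close> form a base with boundaries of dimension at most \<open>d - 1\<close>. Intersecting over
  a sequence of values \<open>d\<close> tending to the infimum gives the upper bound, and monotonicity
  of the dimension gives the lower one.
\<close>

section \<open>Hausdorff dimension\<close>

lemma hausdorff_measure_mono:
  assumes "A \<subseteq> B"
  shows "hausdorff_measure s A \<le> hausdorff_measure s B"
  unfolding hausdorff_measure_def hausdorff_premeasure_def
  by (rule SUP_mono') (use assms in \<open>auto intro!: INF_superset_mono\<close>)

lemma hausdorff_dim_ge_minus_one: "- 1 \<le> hausdorff_dim A"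
proof (cases "A = {}")
  case False
  have "- 1 \<le> Inf {ereal s | s. 0 \<le> s \<and> hausdorff_measure s A = 0}"
  proof (rule Inf_greatest)
    fix x
    assume "x \<in> {ereal s | s. 0 \<le> s \<and> hausdorff_measure s A = 0}"
    then obtain s where "x = ereal s" "0 \<le> s"
      by auto
    then show "- 1 \<le> x"
      by (simp add: one_ereal_def)
  qed
  with False show ?thesis
    by (simp add: hausdorff_dim_def)
qed (simp add: hausdorff_dim_def)

lemma hausdorff_dim_mono:
  assumes "A \<subseteq> B"
  shows "hausdorff_dim A \<le> hausdorff_dim B"
proof (cases "A = {}")
  case True
  then show ?thesis
    using hausdorff_dim_ge_minus_one[of B] by (simp add: hausdorff_dim_def)
next
  case False
  have "hausdorff_measure s A = 0" if "hausdorff_measure s B = 0" for s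
    using hausdorff_measure_mono[OF assms, of s] that by simp
  then have "{ereal s | s. 0 \<le> s \<and> hausdorff_measure s B = 0}
      \<subseteq> {ereal s | s. 0 \<le> s \<and> hausdorff_measure s A = 0}"
    by blast
  then have "Inf {ereal s | s. 0 \<le> s \<and> hausdorff_measure s A = 0}
      \<le> Inf {ereal s | s. 0 \<le> s \<and> hausdorff_measure s B = 0}"
    by (rule Inf_superset_mono)
  then show ?thesis
    using False assms by (auto simp: hausdorff_dim_def)
qed

text \<open>The supremum over \<open>\<delta>\<close> is zero only if every premeasure is. A single
  \<open>e\<close> can then bound both the mesh and the sum, because a cover obtained for
  \<open>min \<delta> e\<close> serves the mesh \<open>\<delta>\<close> and the error
  \<open>e\<close> at once.\<close>

lemma hausdorff_measure_eq_0_iff: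
  "hausdorff_measure s A = 0 \<longleftrightarrow>
    (\<forall>e>0. \<exists>C. A \<subseteq> (\<Union>i::nat. C i) \<and> (\<forall>i. bounded (C i) \<and> diameter (C i) \<le> e) \<and>
      (\<Sum>i. ennreal (diam_pow s (C i))) \<le> ennreal e)"
proof
  assume L: "hausdorff_measure s A = 0"
  show "\<forall>e>0. \<exists>C. A \<subseteq> (\<Union>i::nat. C i) \<and> (\<forall>i. bounded (C i) \<and> diameter (C i) \<le> e) \<and>
      (\<Sum>i. ennreal (diam_pow s (C i))) \<le> ennreal e"
  proof (intro allI impI)
    fix e :: real
    assume e: "e > 0"
    then have "hausdorff_premeasure s e A \<le> hausdorff_measure s A"
      unfolding hausdorff_measure_def by (intro SUP_upper) auto
    with L e have "hausdorff_premeasure s e A < ennreal e"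
      by simp
    then obtain C where
      "C \<in> {C. A \<subseteq> (\<Union>i. C i) \<and> (\<forall>i. bounded (C i) \<and> diameter (C i) \<le> e)}"
      "(\<Sum>i. ennreal (diam_pow s (C i))) < ennreal e"
      unfolding hausdorff_premeasure_def INF_less_iff by blast
    then show "\<exists>C. A \<subseteq> (\<Union>i::nat. C i) \<and> (\<forall>i. bounded (C i) \<and> diameter (C i) \<le> e) \<and>
      (\<Sum>i. ennreal (diam_pow s (C i))) \<le> ennreal e"
      by (intro exI[of _ C]) auto
  qed
next
  assume R: "\<forall>e>0. \<exists>C. A \<subseteq> (\<Union>i::nat. C i) \<and> (\<forall>i. bounded (C i) \<and> diameter (C i) \<le> e) \<and>
      (\<Sum>i. ennreal (diam_pow s (C i))) \<le> ennreal e"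
  have "hausdorff_premeasure s \<delta> A \<le> 0" if \<delta>: "\<delta> > 0" for \<delta>
  proof (rule ennreal_le_epsilon)
    fix e :: real
    assume e: "e > 0"
    obtain C where C: "A \<subseteq> (\<Union>i. C i)" "\<forall>i. bounded (C i) \<and> diameter (C i) \<le> min \<delta> e"
      "(\<Sum>i. ennreal (diam_pow s (C i))) \<le> ennreal (min \<delta> e)"
      using R[rule_format, of "min \<delta> e"] \<delta> e by auto
    have "hausdorff_premeasure s \<delta> A \<le> (\<Sum>i. ennreal (diam_pow s (C i)))"
      unfolding hausdorff_premeasure_def by (rule INF_lower) (use C in auto)
    also note C(3)
    also have "ennreal (min \<delta> e) \<le> 0 + ennreal e"
      by (simp add: ennreal_leI)
    finally show "hausdorff_premeasure s \<delta> A \<le> 0 + ennreal e" .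
  qed
  then show "hausdorff_measure s A = 0"
    unfolding hausdorff_measure_def by (auto intro!: SUP_eqI)
qed

section \<open>Fattening covers to open sets\<close>

lemma diameter_nbhd_le:
  fixes C :: "'a::metric_space set"
  assumes "bounded C" "e \<ge> 0"
  shows "bounded (\<Union>c\<in>C. ball c e)" "diameter (\<Union>c\<in>C. ball c e) \<le> diameter C + 2 * e"
proof -
  have *: "dist x y \<le> diameter C + 2 * e"
    if "x \<in> (\<Union>c\<in>C. ball c e)" "y \<in> (\<Union>c\<in>C. ball c e)" for x y
  proof -
    obtain c d where cd: "c \<in> C" "d \<in> C" "dist c x < e" "dist d y < e"
      using \<open>x \<in> _\<close> \<open>y \<in> _\<close> by auto
    have "dist x y \<le> dist c x + dist c d + dist d y"
      by metric
    moreover have "dist c d \<le> diameter C"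
      using diameter_bounded_bound[OF assms(1)] cd by blast
    ultimately show ?thesis
      using cd by linarith
  qed
  show "bounded (\<Union>c\<in>C. ball c e)"
    unfolding bounded_two_points using * by blast
  show "diameter (\<Union>c\<in>C. ball c e) \<le> diameter C + 2 * e"
  proof (cases "(\<Union>c\<in>C. ball c e) = {}")
    case True
    then show ?thesis
      using assms diameter_ge_0[of C] unfolding True by simp
  next
    case False
    then show ?thesis
      unfolding diameter_def[of "\<Union>c\<in>C. ball c e"]
      by (auto intro!: cSUP_least *)
  qed
qed

text \<open>\<open>W\<close> is a small neighbourhood of \<open>C\<close>. For \<open>s > 0\<close>
  the power of the diameter is continuous in the radius; for \<open>s = 0\<close> only emptiness
  counts, and fattening preserves it.\<close>

lemma open_superset_diam_pow:
  fixes C :: "'a::metric_space set"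
  assumes "bounded C" "0 \<le> s" "e > 0"
  obtains W where "open W" "C \<subseteq> W" "bounded W" "diameter W \<le> diameter C + e"
    "diam_pow s W \<le> diam_pow s C + e"
proof -
  obtain h where h: "h > 0" "2 * h \<le> e"
    and hs: "s > 0 \<Longrightarrow> (diameter C + 2 * h) powr s \<le> diameter C powr s + e"
  proof (cases "s > 0")
    case True
    \<comment> \<open>\<open>diameter C\<close> may be 0. Continuity of \<open>powr\<close> at base
      0 holds here because the exponent is positive and the bases are non-negative.\<close>
    have "((\<lambda>h. (diameter C + 2 * h) powr s) \<longlongrightarrow> (diameter C + 2 * 0) powr s) (at_right 0)"
    proof (rule tendsto_powr2)
      show "\<forall>\<^sub>F h in at_right 0. 0 \<le> diameter C + 2 * h"
        using diameter_ge_0[OF assms(1)] by (auto simp: eventually_at_filter)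
      show "((\<lambda>h. diameter C + 2 * h) \<longlongrightarrow> diameter C + 2 * 0) (at_right 0)"
        by (intro tendsto_intros)
    qed (use True in auto)
    then have "\<forall>\<^sub>F h in at_right 0. (diameter C + 2 * h) powr s < diameter C powr s + e"
      using assms(3) by (intro order_tendstoD) auto
    moreover have "\<forall>\<^sub>F h in at_right 0. 0 < h \<and> h < e / 2"
      using assms(3) by (auto intro!: eventually_at_rightI[of 0 "e / 2"])
    ultimately have "\<forall>\<^sub>F h in at_right 0. (diameter C + 2 * h) powr s < diameter C powr s + e \<and>
        0 < h \<and> h < e / 2"
      by eventually_elim auto
    then obtain h where "(diameter C + 2 * h) powr s < diameter C powr s + e" "0 < h" "h < e / 2"
      using eventually_happens'[OF trivial_limit_at_right_real] by blast
    then show ?thesis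
      by (intro that[of h]) auto
  next
    case False
    then show ?thesis
      using assms(3) by (intro that[of "e / 2"]) auto
  qed
  define W where "W = (\<Union>c\<in>C. ball c h)"
  have W: "bounded W" "diameter W \<le> diameter C + 2 * h"
    unfolding W_def using diameter_nbhd_le[OF assms(1), of h] h by auto
  show ?thesis
  proof
    show "open W" "C \<subseteq> W" "bounded W" "diameter W \<le> diameter C + e"
      using W h by (auto simp: W_def)
    have "W = {} \<longleftrightarrow> C = {}"
      using h by (auto simp: W_def)
    moreover have "diameter W powr s \<le> diameter C powr s + e" if "s > 0"
    proof -
      have "diameter W powr s \<le> (diameter C + 2 * h) powr s"
        using W diameter_ge_0[OF W(1)] assms(2) by (intro powr_mono2) auto
      with hs[OF that] show ?thesis
        by linarith
    qed
    ultimately show "diam_pow s W \<le> diam_pow s C + e"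
      using assms by (auto simp: diam_pow_def)
  qed
qed

lemma diam_pow_nonneg: "0 \<le> diam_pow s C"
  by (simp add: diam_pow_def)

section \<open>Hulls preserving Hausdorff dimension\<close>

text \<open>For each \<open>n\<close> choose an open cover of \<open>A\<close> with mesh and sum at
  most \<open>1/(n+1)\<close>, and intersect the unions over \<open>n\<close>. The
  \<open>n\<close>-th family covers the intersection too, so it witnesses nullity there.\<close>

lemma hausdorff_null_gdelta_hull:
  fixes A :: "'a::metric_space set"
  assumes "0 \<le> s" "hausdorff_measure s A = 0"
  obtains H where "gdelta_in euclidean H" "A \<subseteq> H" "hausdorff_measure s H = 0"
proof -
  have "\<exists>W. A \<subseteq> (\<Union>i::nat. W i) \<and> (\<forall>i. open (W i) \<and> bounded (W i) \<and> diameter (W i) \<le> e) \<and>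
      (\<Sum>i. ennreal (diam_pow s (W i))) \<le> ennreal e" if e: "e > 0" for e
  proof -
    have "e / 3 > 0"
      using e by simp
    then obtain C where C: "A \<subseteq> (\<Union>i::nat. C i)"
      "\<And>i. bounded (C i) \<and> diameter (C i) \<le> e / 3"
      "(\<Sum>i. ennreal (diam_pow s (C i))) \<le> ennreal (e / 3)"
      using assms(2) unfolding hausdorff_measure_eq_0_iff by meson
    \<comment> \<open>The enlargements are geometric with total \<open>e / 3\<close>, so both the
      sum and each diameter grow from at most \<open>e / 3\<close> to at most
      \<open>2 * e / 3\<close>.\<close>
    define d where "d i = e / 3 * (1 / 2) ^ Suc i" for i
    have d: "d i > 0" "d i \<le> e / 3" for i
    proof -
      show "d i > 0"
        using e by (simp add: d_def)
      have "(1 / 2 :: real) ^ Suc i \<le> 1"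
        by (rule power_le_one) auto
      then show "d i \<le> e / 3"
        using e by (simp add: d_def mult_left_le del: power_Suc)
    qed
    have "\<exists>W. open W \<and> C i \<subseteq> W \<and> bounded W \<and> diameter W \<le> diameter (C i) + d i \<and>
        diam_pow s W \<le> diam_pow s (C i) + d i" for i
      using open_superset_diam_pow[OF conjunct1[OF C(2)[of i]] assms(1) d(1)[of i]] by metis
    then obtain W where W: "\<And>i. open (W i)" "\<And>i. C i \<subseteq> W i" "\<And>i. bounded (W i)"
      "\<And>i. diameter (W i) \<le> diameter (C i) + d i"
      "\<And>i. diam_pow s (W i) \<le> diam_pow s (C i) + d i"
      by metis
    have "diameter (W i) \<le> e" for i
      using W(4)[of i] C(2)[of i] d[of i] e by linarith
    moreover have "(\<Sum>i. ennreal (diam_pow s (W i))) \<le> ennreal e"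
    proof -
      have "d sums (e / 3)"
        using sums_mult[OF power_half_series, of "e / 3"] by (simp add: d_def[abs_def])
      then have "(\<Sum>i. ennreal (d i)) = ennreal (e / 3)"
        using d(1) by (intro suminf_ennreal_eq) (auto intro: less_imp_le)
      moreover have "(\<Sum>i. ennreal (diam_pow s (W i))) \<le>
          (\<Sum>i. ennreal (diam_pow s (C i)) + ennreal (d i))"
      proof (rule suminf_le)
        fix i
        show "ennreal (diam_pow s (W i)) \<le> ennreal (diam_pow s (C i)) + ennreal (d i)"
          using W(5)[of i] d(1)[of i] diam_pow_nonneg[of s "C i"]
          by (simp flip: ennreal_plus add: ennreal_leI)
      qed auto
      moreover have "\<dots> = (\<Sum>i. ennreal (diam_pow s (C i))) + (\<Sum>i. ennreal (d i))"
        by (simp add: suminf_add)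
      ultimately have "(\<Sum>i. ennreal (diam_pow s (W i))) \<le>
          (\<Sum>i. ennreal (diam_pow s (C i))) + ennreal (e / 3)"
        by simp
      also have "\<dots> \<le> ennreal (e / 3) + ennreal (e / 3)"
        using C(3) by (rule add_right_mono)
      also have "\<dots> \<le> ennreal e"
        using e by (simp flip: ennreal_plus add: ennreal_leI)
      finally show ?thesis .
    qed
    moreover have "A \<subseteq> (\<Union>i. W i)"
      using C(1) W(2) by blast
    ultimately show ?thesis
      using W(1,3) by (intro exI[of _ W]) auto
  qed
  then have "\<exists>W. A \<subseteq> (\<Union>i::nat. W i) \<and>
      (\<forall>i. open (W i) \<and> bounded (W i) \<and> diameter (W i) \<le> inverse (real (Suc n))) \<and>
      (\<Sum>i. ennreal (diam_pow s (W i))) \<le> ennreal (inverse (real (Suc n)))" for n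
    by simp
  then obtain W where W: "\<And>n. A \<subseteq> (\<Union>i::nat. W n i)"
    "\<And>n i. open (W n i)" "\<And>n i. bounded (W n i)"
    "\<And>n i. diameter (W n i) \<le> inverse (real (Suc n))"
    "\<And>n. (\<Sum>i. ennreal (diam_pow s (W n i))) \<le> ennreal (inverse (real (Suc n)))"
    by metis
  define H where "H = (\<Inter>n. \<Union>i. W n i)"
  show ?thesis
  proof
    show "gdelta_in euclidean H"
      unfolding H_def using W(2)
      by (intro gdelta_in_Inter) (auto intro!: open_imp_gdelta_in)
    show "A \<subseteq> H"
      using W(1) by (auto simp: H_def)
    show "hausdorff_measure s H = 0"
      unfolding hausdorff_measure_eq_0_iff
    proof (intro allI impI)
      fix e :: real
      assume "e > 0"
      then obtain n where n: "inverse (real (Suc n)) < e"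
        using reals_Archimedean by blast
      then have n': "ennreal (inverse (real (Suc n))) \<le> ennreal e"
        by (intro ennreal_leI) simp
      have "H \<subseteq> (\<Union>i. W n i)"
        by (auto simp: H_def)
      moreover have "diameter (W n i) \<le> e" for i
        using W(4)[of n i] n by linarith
      moreover have "(\<Sum>i. ennreal (diam_pow s (W n i))) \<le> ennreal e"
        using W(5)[of n] n' by (rule order_trans)
      ultimately show "\<exists>C. H \<subseteq> (\<Union>i::nat. C i) \<and> (\<forall>i. bounded (C i) \<and> diameter (C i) \<le> e) \<and>
          (\<Sum>i. ennreal (diam_pow s (C i))) \<le> ennreal e"
        using W(3) by (intro exI[of _ "W n"]) auto
    qed
  qed
qed

text \<open>The infimum defining the dimension is reached along a sequence of exponents.
  Intersecting the hulls for these countably many exponents gives a set that is null for each of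
  them.\<close>

lemma hausdorff_dim_gdelta_hull:
  fixes A :: "'a::metric_space set"
  obtains H where "gdelta_in euclidean H" "A \<subseteq> H" "hausdorff_dim H = hausdorff_dim A"
proof (cases "A = {}")
  case True
  then show ?thesis
    using that[of "{}"] by simp
next
  case False
  define S where "S = {ereal s | s. 0 \<le> s \<and> hausdorff_measure s A = 0}"
  have dimA: "hausdorff_dim A = Inf S"
    using False by (simp add: hausdorff_dim_def S_def)
  show ?thesis
  proof (cases "S = {}")
    case True
    \<comment> \<open>With no admissible exponent the dimension is infinite, and the whole space is
      a hull by monotonicity.\<close>
    then have "hausdorff_dim A = \<infinity>"
      using dimA by (simp add: top_ereal_def)
    then have "hausdorff_dim (UNIV :: 'a set) = hausdorff_dim A"
      using hausdorff_dim_mono[of A UNIV] by simp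
    then show ?thesis
      using that[of UNIV] open_imp_gdelta_in[of euclidean UNIV] by simp
  next
    case S: False
    then obtain f where f: "range f \<subseteq> S" "Inf S = (INF n::nat. f n)"
      using Inf_countable_INF by metis
    have "\<forall>n. \<exists>s. f n = ereal s \<and> 0 \<le> s \<and> hausdorff_measure s A = 0"
      using f(1) by (auto simp: S_def)
    then obtain s where s: "\<And>n. f n = ereal (s n)" "\<And>n. 0 \<le> s n"
      "\<And>n. hausdorff_measure (s n) A = 0"
      by metis
    have "\<exists>H. gdelta_in euclidean H \<and> A \<subseteq> H \<and> hausdorff_measure (s n) H = 0" for n
      using hausdorff_null_gdelta_hull[OF s(2)[of n] s(3)[of n]] by metis
    then obtain H where H: "\<And>n. gdelta_in euclidean (H n)" "\<And>n. A \<subseteq> H n"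
      "\<And>n. hausdorff_measure (s n) (H n) = 0"
      by metis
    define K where "K = (\<Inter>n. H n)"
    have "A \<subseteq> K"
      using H(2) by (auto simp: K_def)
    have "hausdorff_measure (s n) K = 0" for n
      using hausdorff_measure_mono[of K "H n" "s n"] H(3)[of n] by (auto simp: K_def)
    then have "hausdorff_dim K \<le> f n" for n
      using False \<open>A \<subseteq> K\<close> s by (auto simp: hausdorff_dim_def intro!: Inf_lower)
    then have "hausdorff_dim K \<le> hausdorff_dim A"
      unfolding dimA f(2) by (intro INF_greatest)
    then have "hausdorff_dim K = hausdorff_dim A"
      using hausdorff_dim_mono[OF \<open>A \<subseteq> K\<close>] by (rule antisym)
    moreover have "gdelta_in euclidean K"
      unfolding K_def using H(1) by (intro gdelta_in_Inter) auto
    ultimately show ?thesis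
      using that \<open>A \<subseteq> K\<close> by blast
  qed
qed

section \<open>Topological Hausdorff dimension\<close>

lemma is_base_of_iff:
  "is_base_of \<U> T \<longleftrightarrow>
    (\<forall>U\<in>\<U>. openin T U) \<and> (\<forall>W x. openin T W \<and> x \<in> W \<longrightarrow> (\<exists>U\<in>\<U>. x \<in> U \<and> U \<subseteq> W))"
  unfolding is_base_of_def openin_topology_base_unique by blast

lemma frontier_of_open_trace_subset:
  assumes "open V"
  shows "top_of_set A frontier_of (A \<inter> V) \<subseteq> A \<inter> (closure V - V)"
proof -
  have "openin (top_of_set A) (A \<inter> V)"
    using assms by auto
  then have "top_of_set A frontier_of (A \<inter> V) = A \<inter> closure (A \<inter> V) - A \<inter> V"
    by (simp add: frontier_of_def interior_of_openin closure_of_subtopology Int_absorb1 flip: Int_assoc)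
  also have "\<dots> \<subseteq> A \<inter> (closure V - V)"
    using closure_mono[of "A \<inter> V" V] by blast
  finally show ?thesis .
qed

text \<open>Traces on \<open>Y\<close> of a base of \<open>G\<close> form a base of
  \<open>Y\<close>, and boundaries only shrink when taken relative to \<open>Y\<close>. Hence each
  \<open>d\<close> admissible for \<open>G\<close> is admissible for \<open>Y\<close>.\<close>

lemma top_hausdorff_dim_mono:
  assumes "Y \<subseteq> G" "Y \<noteq> {}"
  shows "top_hausdorff_dim Y \<le> top_hausdorff_dim G"
proof -
  have "\<exists>\<U>. is_base_of \<U> (top_of_set Y) \<and>
      (\<forall>U\<in>\<U>. hausdorff_dim (top_of_set Y frontier_of U) \<le> d - 1)"
    if \<U>: "is_base_of \<U> (top_of_set G)"
      "\<And>U. U \<in> \<U> \<Longrightarrow> hausdorff_dim (top_of_set G frontier_of U) \<le> d - 1" for \<U> d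
  proof (intro exI conjI ballI)
    have sub: "top_of_set Y = subtopology (top_of_set G) Y"
      using assms by (simp add: subtopology_subtopology Int_absorb1)
    show "is_base_of ((\<inter>) Y ` \<U>) (top_of_set Y)"
      unfolding is_base_of_iff
    proof (intro conjI ballI allI impI)
      fix U assume "U \<in> (\<inter>) Y ` \<U>"
      then obtain T where "T \<in> \<U>" "U = T \<inter> Y"
        by blast
      moreover have "openin (top_of_set G) T"
        using \<U>(1) \<open>T \<in> \<U>\<close> by (simp add: is_base_of_iff)
      ultimately show "openin (top_of_set Y) U"
        unfolding sub openin_subtopology by blast
    next
      fix W x assume W: "openin (top_of_set Y) W \<and> x \<in> W"
      then obtain T where "openin (top_of_set G) T" "W = T \<inter> Y"
        unfolding sub openin_subtopology by blast
      from this W have "x \<in> T"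
        by blast
      with \<open>openin (top_of_set G) T\<close> obtain U where "U \<in> \<U>" "x \<in> U" "U \<subseteq> T"
        using \<U>(1) unfolding is_base_of_iff by meson
      moreover have "x \<in> Y"
        using W \<open>W = T \<inter> Y\<close> by blast
      ultimately show "\<exists>U\<in>(\<inter>) Y ` \<U>. x \<in> U \<and> U \<subseteq> W"
        using \<open>W = T \<inter> Y\<close> by (intro bexI[of _ "Y \<inter> U"]) auto
    qed
    fix V assume "V \<in> (\<inter>) Y ` \<U>"
    then obtain U where U: "U \<in> \<U>" "V = Y \<inter> U"
      by blast
    \<comment> \<open>The boundary in \<open>Y\<close> depends only on the trace, so
      \<open>U\<close> may replace \<open>V\<close>. Written as an intersection of the closures of
      \<open>U\<close> and of its complement, it is monotone in the space in both factors.\<close>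
    have "top_of_set Y frontier_of V = top_of_set Y frontier_of U"
      using frontier_of_restrict[of "top_of_set Y" U] U by simp
    also have "\<dots> \<subseteq> top_of_set G frontier_of U"
      unfolding frontier_of_closures using assms(1)
      by (intro Int_mono order_trans[OF closure_of_subtopology_mono closure_of_mono]) auto
    finally show "hausdorff_dim (top_of_set Y frontier_of V) \<le> d - 1"
      using \<U>(2)[OF U(1)] by (rule order_trans[OF hausdorff_dim_mono])
  qed
  then have "{d. \<exists>\<U>. is_base_of \<U> (top_of_set G) \<and>
        (\<forall>U\<in>\<U>. hausdorff_dim (top_of_set G frontier_of U) \<le> d - 1)} \<subseteq>
      {d. \<exists>\<U>. is_base_of \<U> (top_of_set Y) \<and>
        (\<forall>U\<in>\<U>. hausdorff_dim (top_of_set Y frontier_of U) \<le> d - 1)}"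
    by blast
  then show ?thesis
    using assms by (auto simp: top_hausdorff_dim_def intro!: Inf_superset_mono)
qed

section \<open>Separable subspaces and extension of their open sets\<close>

text \<open>The base consists of balls of radius \<open>1/(n+1)\<close> about a countable dense set.
  It is wanted for the Lindelof property, which makes the covers extracted later countable.\<close>

lemma separable_imp_second_countable_top_of_set:
  fixes Y :: "'a::metric_space set"
  assumes "separable_space (top_of_set Y)"
  shows "second_countable (top_of_set Y)"
proof -
  obtain D where D: "countable D" "D \<subseteq> Y" "top_of_set Y closure_of D = Y"
    using assms by (auto simp: separable_space_def)
  have dense: "\<exists>q\<in>D. dist q y < e" if "y \<in> Y" "e > 0" for y e
  proof -
    have "y \<in> closure D"
      using that D by (metis IntD2 closure_of_subtopology euclidean_closure_of inf.absorb_iff2 inf_commute)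
    then show ?thesis
      using that by (simp add: closure_approachable)
  qed
  define \<B> where "\<B> = (\<lambda>(q, n). Y \<inter> ball q (inverse (real (Suc n)))) ` (D \<times> (UNIV :: nat set))"
  show ?thesis
    unfolding second_countable_def
  proof (intro exI[of _ \<B>] conjI ballI allI impI)
    show "countable \<B>"
      using D by (simp add: \<B>_def)
    show "openin (top_of_set Y) V" if "V \<in> \<B>" for V
      using that by (auto simp: \<B>_def)
    fix U x assume U: "openin (top_of_set Y) U \<and> x \<in> U"
    then have x: "x \<in> Y"
      using openin_imp_subset by blast
    obtain e where e: "e > 0" "ball x e \<inter> Y \<subseteq> U"
      using U openin_contains_ball by metis
    obtain n where n: "inverse (real (Suc n)) < e / 2"
      using reals_Archimedean[of "e / 2"] e by auto
    obtain q where q: "q \<in> D" "dist q x < inverse (real (Suc n))"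
      using dense[OF x, of "inverse (real (Suc n))"] by auto
    have "Y \<inter> ball q (inverse (real (Suc n))) \<subseteq> U"
    proof
      fix z assume z: "z \<in> Y \<inter> ball q (inverse (real (Suc n)))"
      have "dist x z \<le> dist q x + dist q z"
        by metric
      also have "\<dots> < e"
        using z q n by auto
      finally show "z \<in> U"
        using z e by auto
    qed
    then show "\<exists>V\<in>\<B>. x \<in> V \<and> V \<subseteq> U"
      using q x by (intro bexI[of _ "Y \<inter> ball q (inverse (real (Suc n)))"]) (auto simp: \<B>_def)
  qed
qed

text \<open>Halving the radii keeps \<open>V\<close> away from the points of \<open>Y\<close> that are not in the closure
  of \<open>U\<close>, so on \<open>Y\<close> the extension acquires no new boundary points.\<close>

lemma open_extension:
  fixes Y :: "'a::metric_space set"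
  assumes "openin (top_of_set Y) U" "e > 0"
  obtains V where "open V" "Y \<inter> V = U" "V \<subseteq> (\<Union>u\<in>U. ball u e)"
    "Y \<inter> (closure V - V) \<subseteq> top_of_set Y frontier_of U"
proof -
  have UY: "U \<subseteq> Y"
    using assms openin_imp_subset by blast
  have "\<forall>u\<in>U. \<exists>r>0. ball u r \<inter> Y \<subseteq> U"
    using assms(1) openin_contains_ball by metis
  then obtain r where r: "\<And>u. u \<in> U \<Longrightarrow> r u > 0" "\<And>u. u \<in> U \<Longrightarrow> ball u (r u) \<inter> Y \<subseteq> U"
    by metis
  define V where "V = (\<Union>u\<in>U. ball u (min e (r u / 2)))"
  have YV: "Y \<inter> V = U"
  proof
    show "Y \<inter> V \<subseteq> U"
    proof
      fix y assume "y \<in> Y \<inter> V"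
      then obtain u where u: "u \<in> U" "dist u y < r u / 2" "y \<in> Y"
        by (auto simp: V_def)
      with r(1)[OF u(1)] have "y \<in> ball u (r u) \<inter> Y"
        by simp
      with r(2)[OF u(1)] show "y \<in> U"
        by blast
    qed
    show "U \<subseteq> Y \<inter> V"
    proof
      fix u assume u: "u \<in> U"
      then have "u \<in> ball u (min e (r u / 2))"
        using r(1) assms(2) by simp
      with u UY show "u \<in> Y \<inter> V"
        unfolding V_def by blast
    qed
  qed
  show ?thesis
  proof
    show "open V"
      by (auto simp: V_def)
    show "V \<subseteq> (\<Union>u\<in>U. ball u e)"
      by (auto simp: V_def)
    show "Y \<inter> V = U"
      by (rule YV)
    show "Y \<inter> (closure V - V) \<subseteq> top_of_set Y frontier_of U"
    proof
      fix y assume y: "y \<in> Y \<inter> (closure V - V)"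
      then have yU: "y \<notin> U"
        using YV by blast
      have "y \<in> closure U"
        unfolding closure_approachable
      proof (intro allI impI)
        fix d :: real assume "d > 0"
        then obtain z where z: "z \<in> V" "dist z y < d / 2"
          using y by (auto simp: closure_approachable dest!: spec[of _ "d / 2"])
        then obtain u where u: "u \<in> U" "dist u z < r u / 2"
          by (auto simp: V_def)
        \<comment> \<open>The ball of radius \<open>r u\<close> meets \<open>Y\<close> only in
          \<open>U\<close>, so it misses \<open>y\<close>. Since \<open>z\<close> is within
          \<open>r u / 2\<close> of \<open>u\<close>, the triangle inequality forces
          \<open>r u < d\<close>, and then \<open>dist u y < d\<close>.\<close>
        have "r u \<le> dist u y"
          using r(2)[OF u(1)] y yU by force
        moreover have "dist u y \<le> dist u z + dist z y"
          by metric
        ultimately have "dist u y < d"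
          using u z by linarith
        with u show "\<exists>x\<in>U. dist x y < d"
          by blast
      qed
      then show "y \<in> top_of_set Y frontier_of U"
        using y yU UY assms(1)
        by (simp add: frontier_of_def interior_of_openin closure_of_subtopology Int_absorb1)
    qed
  qed
qed

text \<open>\<open>E\<close> removes from the boundary of \<open>V\<close> all points outside a hull
  \<open>H\<close> of the boundary of \<open>U\<close> in \<open>Y\<close>. No point of
  \<open>Y\<close> is lost, since those on the boundary of \<open>V\<close> already lie in
  \<open>H\<close>.\<close>

lemma gdelta_extension:
  fixes Y :: "'a::metric_space set"
  assumes "openin (top_of_set Y) U" "e > 0"
  obtains V E where "open V" "Y \<inter> V = U" "V \<subseteq> (\<Union>u\<in>U. ball u e)"
    "gdelta_in euclidean E" "Y \<subseteq> E"
    "hausdorff_dim (E \<inter> (closure V - V)) \<le> hausdorff_dim (top_of_set Y frontier_of U)"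
proof -
  obtain V where V: "open V" "Y \<inter> V = U" "V \<subseteq> (\<Union>u\<in>U. ball u e)"
    "Y \<inter> (closure V - V) \<subseteq> top_of_set Y frontier_of U"
    using open_extension[OF assms] by blast
  obtain H where H: "gdelta_in euclidean H" "top_of_set Y frontier_of U \<subseteq> H"
    "hausdorff_dim H = hausdorff_dim (top_of_set Y frontier_of U)"
    using hausdorff_dim_gdelta_hull by blast
  \<comment> \<open>The complement of the boundary is a union of two open sets, so \<open>E\<close>
    is a union of two \<open>G\<^sub>\<delta>\<close> sets.\<close>
  define E where "E = (- closure V \<union> V) \<union> H"
  show ?thesis
  proof
    show "gdelta_in euclidean E"
      unfolding E_def using H(1) V(1)
      by (intro gdelta_in_Un) (auto intro!: open_imp_gdelta_in simp: open_Compl)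
    show "Y \<subseteq> E"
      using V(4) H(2) by (auto simp: E_def)
    show "hausdorff_dim (E \<inter> (closure V - V)) \<le> hausdorff_dim (top_of_set Y frontier_of U)"
      unfolding H(3)[symmetric] by (rule hausdorff_dim_mono) (auto simp: E_def)
  qed (use V in auto)
qed

section \<open>The hull for one bound on the boundary dimension\<close>

text \<open>The conclusion covers every \<open>A \<subseteq> G\<close> because such hulls are later
  intersected, and the bound must survive passing to the smaller set.\<close>

lemma gdelta_hull_with_base:
  fixes Y :: "'a::metric_space set"
  assumes sep: "separable_space (top_of_set Y)"
    and base: "is_base_of \<U> (top_of_set Y)"
    and dim: "\<And>U. U \<in> \<U> \<Longrightarrow> hausdorff_dim (top_of_set Y frontier_of U) \<le> c"
  obtains G where "gdelta_in euclidean G" "Y \<subseteq> G"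
    "\<And>A. A \<subseteq> G \<Longrightarrow> \<exists>\<V>. is_base_of \<V> (top_of_set A) \<and>
      (\<forall>V\<in>\<V>. hausdorff_dim (top_of_set A frontier_of V) \<le> c)"
proof -
  have lind: "Lindelof_space (top_of_set Y)"
    using sep by (intro second_countable_imp_Lindelof_space separable_imp_second_countable_top_of_set)
  define \<epsilon> where "\<epsilon> k = inverse (real (Suc k))" for k
  have \<epsilon>: "\<epsilon> k > 0" for k
    by (simp add: \<epsilon>_def)
  \<comment> \<open>Members of the base lying in a ball of radius \<open>\<epsilon> k\<close> cover
    \<open>Y\<close>; Lindelof leaves countably many, so that \<open>G\<close> becomes a countable
    intersection.\<close>
  have ex: "\<exists>\<W>. countable \<W> \<and> \<W> \<subseteq> {U \<in> \<U>. \<forall>x\<in>U. \<forall>y\<in>U. dist x y < 2 * \<epsilon> k} \<and> \<Union>\<W> = Y" for k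
  proof -
    let ?\<S> = "{U \<in> \<U>. \<forall>x\<in>U. \<forall>y\<in>U. dist x y < 2 * \<epsilon> k}"
    have op: "\<forall>U\<in>?\<S>. openin (top_of_set Y) U"
      using base by (auto simp: is_base_of_iff)
    have "y \<in> \<Union>?\<S>" if "y \<in> Y" for y
    proof -
      have "openin (top_of_set Y) (Y \<inter> ball y (\<epsilon> k))" "y \<in> Y \<inter> ball y (\<epsilon> k)"
        using that \<epsilon> by auto
      then obtain U where U: "U \<in> \<U>" "y \<in> U" "U \<subseteq> Y \<inter> ball y (\<epsilon> k)"
        using base unfolding is_base_of_iff by meson
      have "dist a b < 2 * \<epsilon> k" if "a \<in> U" "b \<in> U" for a b
      proof -
        have "dist a b \<le> dist y a + dist y b"
          by metric
        moreover have "dist y a < \<epsilon> k" "dist y b < \<epsilon> k"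
          using U(3) that by auto
        ultimately show ?thesis
          by linarith
      qed
      with U show ?thesis
        by blast
    qed
    then have "topspace (top_of_set Y) \<subseteq> \<Union>?\<S>"
      by auto
    then obtain \<W> where \<W>: "countable \<W>" "\<W> \<subseteq> ?\<S>" "Y \<subseteq> \<Union>\<W>"
      using lind op unfolding Lindelof_space_alt topspace_euclidean_subtopology by meson
    have "U \<subseteq> Y" if "U \<in> \<W>" for U
      using op \<W>(2) that by (intro openin_imp_subset) blast
    then have "\<Union>\<W> = Y"
      using \<W>(3) by blast
    with \<W> show ?thesis
      by (intro exI[of _ \<W>] conjI)
  qed
  have "\<exists>\<W>. \<forall>k. countable (\<W> k) \<and>
      \<W> k \<subseteq> {U \<in> \<U>. \<forall>x\<in>U. \<forall>y\<in>U. dist x y < 2 * \<epsilon> k} \<and> \<Union>(\<W> k) = Y"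
    by (rule choice) (intro allI ex)
  then obtain \<W> where "\<forall>k. countable (\<W> k) \<and>
      \<W> k \<subseteq> {U \<in> \<U>. \<forall>x\<in>U. \<forall>y\<in>U. dist x y < 2 * \<epsilon> k} \<and> \<Union>(\<W> k) = Y"
    by (rule exE)
  then have \<W>: "\<And>k. countable (\<W> k)" "\<And>k. \<W> k \<subseteq> \<U>" "\<And>k. \<Union>(\<W> k) = Y"
    and small: "\<And>k U x y. U \<in> \<W> k \<Longrightarrow> x \<in> U \<Longrightarrow> y \<in> U \<Longrightarrow> dist x y < 2 * \<epsilon> k"
    by blast+
  define P where "P k U V E \<longleftrightarrow> open V \<and> Y \<inter> V = U \<and> V \<subseteq> (\<Union>u\<in>U. ball u (\<epsilon> k)) \<and>
      gdelta_in euclidean E \<and> Y \<subseteq> E \<and> hausdorff_dim (E \<inter> (closure V - V)) \<le> c" for k U V E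
  have ex: "\<exists>V E. P k U V E"
    if "U \<in> \<W> k" for U k
  proof -
    have U: "U \<in> \<U>"
      using that \<W>(2) by blast
    then have "openin (top_of_set Y) U"
      using base by (simp add: is_base_of_iff)
    from gdelta_extension[OF this \<epsilon>[of k]] dim[OF U] show ?thesis
      unfolding P_def by (metis order_trans)
  qed
  \<comment> \<open>Two successive choices: \<open>E\<close> must be chosen for the \<open>V\<close>
    already fixed.\<close>
  define V where "V k U = (SOME V. \<exists>E. P k U V E)" for k U
  define E where "E k U = (SOME E. P k U (V k U) E)" for k U
  have "P k U (V k U) (E k U)" if "U \<in> \<W> k" for k U
    unfolding E_def V_def by (intro someI_ex[of "P k U _"] someI_ex[of "\<lambda>V. \<exists>E. P k U V E"] ex that)
  then have V: "\<And>U k. U \<in> \<W> k \<Longrightarrow> open (V k U)" "\<And>U k. U \<in> \<W> k \<Longrightarrow> Y \<inter> V k U = U"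
      "\<And>U k. U \<in> \<W> k \<Longrightarrow> V k U \<subseteq> (\<Union>u\<in>U. ball u (\<epsilon> k))"
    and E: "\<And>U k. U \<in> \<W> k \<Longrightarrow> gdelta_in euclidean (E k U)" "\<And>U k. U \<in> \<W> k \<Longrightarrow> Y \<subseteq> E k U"
      "\<And>U k. U \<in> \<W> k \<Longrightarrow> hausdorff_dim (E k U \<inter> (closure (V k U) - V k U)) \<le> c"
    unfolding P_def by simp_all
  \<comment> \<open>The first factor keeps the points covered at every scale, the second makes the
    boundaries thin. \<open>UNIV\<close> keeps the second family non-empty even if there is no
    \<open>E k U\<close>.\<close>
  define G where "G = (\<Inter>k. \<Union>(V k ` \<W> k)) \<inter> \<Inter>(insert UNIV (\<Union>k. E k ` \<W> k))"
  show ?thesis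
  proof
    show "gdelta_in euclidean G"
      unfolding G_def
    proof (intro gdelta_in_Int gdelta_in_Inter)
      show "gdelta_in euclidean S" if "S \<in> range (\<lambda>k. \<Union>(V k ` \<W> k))" for S
        using that V(1) by (auto intro!: open_imp_gdelta_in)
      show "gdelta_in euclidean S" if "S \<in> insert UNIV (\<Union>k. E k ` \<W> k)" for S
        using that E(1) open_imp_gdelta_in[of euclidean UNIV] by auto
    qed (use \<W>(1) in auto)
    show "Y \<subseteq> G"
    proof
      fix y assume y: "y \<in> Y"
      have "y \<in> \<Union>(V k ` \<W> k)" for k
        using y \<W>(3)[of k] V(2)[of _ k] by blast
      then show "y \<in> G"
        using y E(2) by (auto simp: G_def)
    qed
    fix A assume A: "A \<subseteq> G"
    define \<V> where "\<V> = (\<Union>k. (\<lambda>U. A \<inter> V k U) ` \<W> k)"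
    show "\<exists>\<V>. is_base_of \<V> (top_of_set A) \<and>
      (\<forall>V\<in>\<V>. hausdorff_dim (top_of_set A frontier_of V) \<le> c)"
    proof (intro exI[of _ \<V>] conjI ballI)
      show "is_base_of \<V> (top_of_set A)"
        unfolding is_base_of_iff
      proof (intro conjI ballI allI impI)
        show "openin (top_of_set A) B" if "B \<in> \<V>" for B
          using that V(1) by (auto simp: \<V>_def)
        fix W x assume W: "openin (top_of_set A) W \<and> x \<in> W"
        then obtain r where r: "r > 0" "ball x r \<inter> A \<subseteq> W" and x: "x \<in> A"
          using openin_contains_ball openin_imp_subset by (metis subsetD)
        \<comment> \<open>Both \<open>x\<close> and \<open>z\<close> will lie within
          \<open>\<epsilon> k\<close> of points of \<open>U\<close>, and these are less than
          \<open>2 * \<epsilon> k\<close> apart. The total is below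
          \<open>4 * \<epsilon> k < r\<close>.\<close>
        obtain k where k: "\<epsilon> k < r / 4"
          using reals_Archimedean[of "r / 4"] r by (auto simp: \<epsilon>_def)
        have "x \<in> \<Union>(V k ` \<W> k)"
          using A x unfolding G_def by blast
        then obtain U where U: "U \<in> \<W> k" "x \<in> V k U"
          by blast
        have "A \<inter> V k U \<subseteq> W"
        proof
          fix z assume z: "z \<in> A \<inter> V k U"
          have "\<exists>u\<in>U. dist u t < \<epsilon> k" if "t \<in> V k U" for t
            using subsetD[OF V(3)[OF U(1)] that] by simp
          then obtain u v where uv: "u \<in> U" "v \<in> U" "dist u x < \<epsilon> k" "dist v z < \<epsilon> k"
            using U(2) z by (meson IntD2)
          have "dist x z \<le> dist u x + dist u v + dist v z"
            by metric
          also have "\<dots> < r"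
            using uv k small[OF U(1) uv(1,2)] by linarith
          finally show "z \<in> W"
            using z r by auto
        qed
        then show "\<exists>B\<in>\<V>. x \<in> B \<and> B \<subseteq> W"
          using U x by (auto simp: \<V>_def)
      qed
      fix B assume "B \<in> \<V>"
      then obtain k U where U: "U \<in> \<W> k" "B = A \<inter> V k U"
        by (auto simp: \<V>_def)
      have "top_of_set A frontier_of B \<subseteq> A \<inter> (closure (V k U) - V k U)"
        unfolding U(2) by (rule frontier_of_open_trace_subset[OF V(1)[OF U(1)]])
      \<comment> \<open>\<open>A\<close> lies in \<open>G\<close>, hence in \<open>E k U\<close>,
        where the dimension of this boundary is controlled.\<close>
      also have "\<dots> \<subseteq> E k U \<inter> (closure (V k U) - V k U)"
        using A U(1) by (auto simp: G_def)
      finally show "hausdorff_dim (top_of_set A frontier_of B) \<le> c"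
        using E(3)[OF U(1)] by (rule order_trans[OF hausdorff_dim_mono])
    qed
  qed
qed

section \<open>Passage to the infimum over admissible bounds\<close>

theorem theorem4p18:
  fixes X Y :: "'a::metric_space set"
  assumes "Y \<subseteq> X"
    and "separable_space (top_of_set Y)"
  shows "\<exists>G. gdelta_in (top_of_set X) G \<and> Y \<subseteq> G \<and> top_hausdorff_dim G = top_hausdorff_dim Y"
proof (cases "Y = {}")
  case True
  then show ?thesis
    by (intro exI[of _ "{}"]) auto
next
  case False
  define S where "S A = {d. \<exists>\<U>. is_base_of \<U> (top_of_set A) \<and>
      (\<forall>U\<in>\<U>. hausdorff_dim (top_of_set A frontier_of U) \<le> d - 1)}" for A :: "'a set"
  have dim: "top_hausdorff_dim A = Inf (S A)" if "A \<noteq> {}" for A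
    using that by (simp add: top_hausdorff_dim_def S_def)
  have "is_base_of {U. openin (top_of_set Y) U} (top_of_set Y)"
    by (auto simp: is_base_of_iff)
  \<comment> \<open>Since \<open>\<infinity> - 1 = \<infinity>\<close>, the base of all open sets
    qualifies. So \<open>S Y\<close> is non-empty and its infimum is that of a sequence.\<close>
  then have "\<infinity> \<in> S Y"
    by (auto simp: S_def)
  then obtain f where f: "range f \<subseteq> S Y" "Inf (S Y) = (INF n::nat. f n)"
    using Inf_countable_INF by (metis empty_iff)
  have "\<exists>G. gdelta_in euclidean G \<and> Y \<subseteq> G \<and> (\<forall>A. A \<subseteq> G \<longrightarrow> f n \<in> S A)" for n
  proof -
    have "f n \<in> S Y"
      using f(1) by blast
    then obtain \<U> where \<U>: "is_base_of \<U> (top_of_set Y)"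
      "\<And>U. U \<in> \<U> \<Longrightarrow> hausdorff_dim (top_of_set Y frontier_of U) \<le> f n - 1"
      unfolding S_def by blast
    obtain G where "gdelta_in euclidean G" "Y \<subseteq> G"
      "\<And>A. A \<subseteq> G \<Longrightarrow> \<exists>\<V>. is_base_of \<V> (top_of_set A) \<and>
        (\<forall>V\<in>\<V>. hausdorff_dim (top_of_set A frontier_of V) \<le> f n - 1)"
      using gdelta_hull_with_base[OF assms(2) \<U>] by blast
    then show ?thesis
      unfolding S_def by blast
  qed
  then obtain G where G: "\<And>n. gdelta_in euclidean (G n)" "\<And>n. Y \<subseteq> G n"
    "\<And>n A. A \<subseteq> G n \<Longrightarrow> f n \<in> S A"
    by metis
  \<comment> \<open>Being contained in every \<open>G n\<close>, \<open>K\<close> admits each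
    \<open>f n\<close>; intersecting with \<open>X\<close> makes it a
    \<open>G\<^sub>\<delta>\<close> set relative to \<open>X\<close>.\<close>
  define K where "K = (\<Inter>n. G n) \<inter> X"
  have YK: "Y \<subseteq> K"
    using assms(1) G(2) by (auto simp: K_def)
  have "gdelta_in euclidean (\<Inter>n. G n)"
    using G(1) by (intro gdelta_in_Inter) auto
  then have gd: "gdelta_in (top_of_set X) K"
    unfolding gdelta_in_subtopology K_def by blast
  have "Inf (S K) \<le> f n" for n
    by (rule Inf_lower, rule G(3)) (auto simp: K_def)
  then have "Inf (S K) \<le> Inf (S Y)"
    unfolding f(2) by (intro INF_greatest)
  then have "top_hausdorff_dim K \<le> top_hausdorff_dim Y"
    using False YK by (subst (1 2) dim) auto
  with top_hausdorff_dim_mono[OF YK False] gd YK show ?thesis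
    by (intro exI[of _ K]) auto
qed

end
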